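(* Let $(\mathfrak g,\cdot)$ be an associative algebra over $\mathbf K$ and set $\pi(x,y)=x\cdot y$, regarded as an element of $\mathfrak C^1_{\mathsf{Ass}}(\mathfrak g,\mathfrak g)=\operatorname{Hom}(\otimes^2\mathfrak g,\mathfrak g)$. Let $\mathrm d$ be the Hochschild coboundary operator of $(\mathfrak g,\cdot)$ associated to the regular representation, and let $d_\pi=[\pi,\cdot]_{\mathsf G}$, where $[\cdot,\cdot]_{\mathsf G}$ is the Gerstenhaber bracket. Then for every $n=1,2,\ldots$ and every $f\in\mathfrak C^{n-1}_{\mathsf{Ass}}(\mathfrak g,\mathfrak g)=\operatorname{Hom}(\otimes^n\mathfrak g,\mathfrak g)$, $$\mathrm d f=(-1)^{n-1}d_\pi f=(-1)^{n-1}[\pi,f]_{\mathsf G}.$$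
   Context: $\mathbf K$ is a field of characteristic $0$; associative algebras are not assumed unital. For a vector space $\mathfrak g$ and $p\ge 0$, put $\mathfrak C^p_{\mathsf{Ass}}(\mathfrak g,\mathfrak g)=\operatorname{Hom}(\otimes^{p+1}\mathfrak g,\mathfrak g)$, whose elements have degree $p$. For $P\in\mathfrak C^p_{\mathsf{Ass}}(\mathfrak g,\mathfrak g)$ and $Q\in\mathfrak C^q_{\mathsf{Ass}}(\mathfrak g,\mathfrak g)$ define $P\circ Q\in\mathfrak C^{p+q}_{\mathsf{Ass}}(\mathfrak g,\mathfrak g)$ by $$(P\circ Q)(x_1,\ldots,x_{p+q+1})=\sum_{i=1}^{p+1}(-1)^{(i-1)q}P(x_1,\ldots,x_{i-1},Q(x_i,\ldots,x_{i+q}),x_{i+q+1},\ldots,x_{p+q+1}).$$ The Gerstenhaber bracket is $[P,Q]_{\mathsf G}=P\circ Q-(-1)^{pq}Q\circ P$. The Hochschild coboundary operator associated to the regular representation is the map $\mathrm d:\operatorname{Hom}(\otimes^n\mathfrak g,\mathfrak g)\to\operatorname{Hom}(\otimes^{n+1}\mathfrak g,\mathfrak g)$ given by $$(\mathrm df)(x_1,\ldots,x_{n+1})=x_1\cdot f(x_2,\ldots,x_{n+1})+\sum_{i=1}^n(-1)^if(x_1,\ldots,x_{i-1},x_i\cdot x_{i+1},\ldots,x_{n+1})+(-1)^{n+1}f(x_1,\ldots,x_n)\cdot x_{n+1}.$$ *)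

theory Defs
  imports Complex_Main
begin

text \<open>
  The carrier of \<open>\<gg>\<close> is a whole type. Elements of \<open>Hom(\<otimes>\<^sup>n \<gg>, \<gg>)\<close> are identified with
  \<open>n\<close>-linear maps \<open>\<gg>\<^sup>n \<rightarrow> \<gg>\<close>, represented as functions on lists. Off the lists of length \<open>n\<close>
  such a function is required to be \<open>0\<close>, so that equality of functions is equality of multilinear
  maps. All cochain operations below respect this convention. They take the
  degrees of their arguments as explicit parameters.
\<close>

locale assoc_algebra = vector_space scale
  for scale :: "'k::field_char_0 \<Rightarrow> 'g::ring \<Rightarrow> 'g" +
  assumes scale_mult_left: "scale a x * y = scale a (x * y)"
    and scale_mult_right: "x * scale a y = scale a (x * y)"

definition multilinear_maps :: "('k::field \<Rightarrow> 'g::ab_group_add \<Rightarrow> 'g) \<Rightarrow> nat \<Rightarrow> ('g list \<Rightarrow> 'g) set"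
  where "multilinear_maps scale n =
    {f. (\<forall>xs. length xs = n \<longrightarrow> (\<forall>j<n. Vector_Spaces.linear scale scale (\<lambda>x. f (xs[j := x])))) \<and>
        (\<forall>xs. length xs \<noteq> n \<longrightarrow> f xs = 0)}"

definition cochains :: "('k::field \<Rightarrow> 'g::ab_group_add \<Rightarrow> 'g) \<Rightarrow> nat \<Rightarrow> ('g list \<Rightarrow> 'g) set"
  where "cochains scale p = multilinear_maps scale (p + 1)"

text \<open>
  In the formulas below, the summation index \<open>i\<close> is 1-based as on paper, while lists are 0-based:
  \<open>x\<^sub>i\<close> is \<open>xs ! (i - 1)\<close>.
\<close>

definition gcirc ::
    "('k::field \<Rightarrow> 'g::ab_group_add \<Rightarrow> 'g) \<Rightarrow> nat \<Rightarrow> nat \<Rightarrow> ('g list \<Rightarrow> 'g) \<Rightarrow> ('g list \<Rightarrow> 'g) \<Rightarrow> 'g list \<Rightarrow> 'g"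
  where "gcirc scale p q P Q = (\<lambda>xs. if length xs = p + q + 1
    then \<Sum>i=1..p+1. scale ((- 1) ^ ((i - 1) * q))
      (P (take (i - 1) xs @ [Q (take (q + 1) (drop (i - 1) xs))] @ drop (i + q) xs))
    else 0)"

definition gerstenhaber_bracket ::
    "('k::field \<Rightarrow> 'g::ab_group_add \<Rightarrow> 'g) \<Rightarrow> nat \<Rightarrow> nat \<Rightarrow> ('g list \<Rightarrow> 'g) \<Rightarrow> ('g list \<Rightarrow> 'g) \<Rightarrow> 'g list \<Rightarrow> 'g"
  where "gerstenhaber_bracket scale p q P Q =
    (\<lambda>xs. gcirc scale p q P Q xs - scale ((- 1) ^ (p * q)) (gcirc scale q p Q P xs))"

definition mult_cochain :: "'g::ring list \<Rightarrow> 'g"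
  where "mult_cochain = (\<lambda>xs. if length xs = 2 then xs ! 0 * xs ! 1 else 0)"

definition d_pi :: "('k::field \<Rightarrow> 'g::ring \<Rightarrow> 'g) \<Rightarrow> nat \<Rightarrow> ('g list \<Rightarrow> 'g) \<Rightarrow> 'g list \<Rightarrow> 'g"
  where "d_pi scale q = gerstenhaber_bracket scale 1 q mult_cochain"

text \<open>The coboundary on \<open>Hom(\<otimes>\<^sup>n \<gg>, \<gg>)\<close>; here \<open>n\<close> is the arity, not the degree \<open>n - 1\<close>.\<close>

definition hochschild_d :: "('k::field \<Rightarrow> 'g::ring \<Rightarrow> 'g) \<Rightarrow> nat \<Rightarrow> ('g list \<Rightarrow> 'g) \<Rightarrow> 'g list \<Rightarrow> 'g"
  where "hochschild_d scale n f = (\<lambda>xs. if length xs = n + 1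
    then xs ! 0 * f (drop 1 xs)
      + (\<Sum>i=1..n. scale ((- 1) ^ i)
          (f (take (i - 1) xs @ [xs ! (i - 1) * xs ! i] @ drop (i + 1) xs)))
      + scale ((- 1) ^ (n + 1)) (f (take n xs) * xs ! n)
    else 0)"

lemma (in assoc_algebra) mult_cochain_in_cochains: "mult_cochain \<in> cochains scale 1"
proof -
  have "Vector_Spaces.linear scale scale (\<lambda>x. mult_cochain (xs[j := x]))"
    if "length xs = 2" "j < 2" for xs j
  proof -
    obtain a b where "xs = [a, b]"
      using \<open>length xs = 2\<close> by (auto simp: length_Suc_conv numeral_2_eq_2)
    moreover have "j = 0 \<or> j = 1"
      using \<open>j < 2\<close> by auto
    ultimately show ?thesis
      by unfold_locales
        (auto simp: mult_cochain_def algebra_simps scale_mult_left scale_mult_right)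
  qed
  then show ?thesis
    by (simp add: cochains_def multilinear_maps_def mult_cochain_def)
qed

lemma gcirc_in_cochains:
  assumes "vector_space scale" and P: "P \<in> cochains scale p" and Q: "Q \<in> cochains scale q"
  shows "gcirc scale p q P Q \<in> cochains scale (p + q)"
proof -
  interpret vector_space scale by fact
  interpret vector_space_pair scale scale ..
  have PL: "Vector_Spaces.linear scale scale (\<lambda>x. P (xs[j := x]))" if "length xs = p + 1" "j < p + 1" for xs j
    using P that by (simp add: cochains_def multilinear_maps_def)
  have QL: "Vector_Spaces.linear scale scale (\<lambda>x. Q (xs[j := x]))" if "length xs = q + 1" "j < q + 1" for xs j
    using Q that by (simp add: cochains_def multilinear_maps_def)
  have "Vector_Spaces.linear scale scale (\<lambda>x. P (take k (xs[j := x]) @ [Q (take (q + 1) (drop k (xs[j := x])))] @ drop (Suc (k + q)) (xs[j := x])))"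
    if L: "length xs = p + q + 1" and j: "j < p + q + 1" and k: "k \<le> p" for xs j k
  proof -
    let ?ys = "take k xs @ [Q (take (q + 1) (drop k xs))] @ drop (Suc (k + q)) xs"
    have ly: "length ?ys = p + 1" using L k by auto
    consider "j < k" | "k \<le> j" "j \<le> k + q" | "k + q < j" by linarith
    then show ?thesis
    proof cases
      case 1
      then have "(\<lambda>x. P (take k (xs[j := x]) @ [Q (take (q + 1) (drop k (xs[j := x])))] @ drop (Suc (k + q)) (xs[j := x]))) = (\<lambda>x. P (?ys[j := x]))"
        using L k by (simp add: list_update_append take_update_swap)
      then show ?thesis using PL[OF ly, of j] 1 k by simp
    next
      case 2
      let ?zs = "take (q + 1) (drop k xs)"
      have "(\<lambda>x. P (take k (xs[j := x]) @ [Q (take (q + 1) (drop k (xs[j := x])))] @ drop (Suc (k + q)) (xs[j := x]))) = (\<lambda>y. P (?ys[k := y])) \<circ> (\<lambda>x. Q (?zs[j - k := x]))"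
        using L k 2 by (simp add: list_update_append take_update_swap drop_update_swap list_update_beyond fun_eq_iff)
      moreover have "length ?zs = q + 1" "j - k < q + 1" using L k 2 by auto
      ultimately show ?thesis using PL[OF ly, of k] QL[of ?zs "j - k"] k Vector_Spaces.linear_compose by (metis le_imp_less_Suc Suc_eq_plus1)
    next
      case 3
      then obtain e where e: "j = Suc (k + q + e)" using less_imp_Suc_add by blast
      then have "j - q = Suc (k + e)" by simp
      then have "(\<lambda>x. P (take k (xs[j := x]) @ [Q (take (q + 1) (drop k (xs[j := x])))] @ drop (Suc (k + q)) (xs[j := x]))) = (\<lambda>x. P (?ys[j - q := x]))"
        using L k e by (simp add: list_update_append take_update_swap drop_update_swap list_update_beyond fun_eq_iff)
      then show ?thesis using PL[OF ly, of "j-q"] 3 j by simp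
    qed
  qed
  note lin = this
  have "Vector_Spaces.linear scale scale (\<lambda>x. gcirc scale p q P Q (xs[j := x]))"
    if L: "length xs = p + q + 1" and j: "j < p + q + 1" for xs j
  proof -
    have "Vector_Spaces.linear scale scale (\<lambda>x. \<Sum>i=1..p+1. scale ((- 1) ^ ((i - 1) * q))
        (P (take (i - 1) (xs[j := x]) @ [Q (take (q + 1) (drop (i - 1) (xs[j := x])))] @ drop (i + q) (xs[j := x]))))"
    proof (rule linear_compose_sum, intro ballI linear_compose_scale_right)
      fix i assume "i \<in> {1..p+1}"
      then have "i - 1 \<le> p" "Suc (i - 1 + q) = i + q" by auto
      then show "Vector_Spaces.linear scale scale (\<lambda>x. P (take (i - 1) (xs[j := x]) @
          [Q (take (q + 1) (drop (i - 1) (xs[j := x])))] @ drop (i + q) (xs[j := x])))"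
        using lin[OF L j, of "i - 1"] by (simp only:)
    qed
    then show ?thesis using L unfolding gcirc_def by (simp only: length_list_update if_True refl)
  qed
  then show ?thesis
    by (simp add: cochains_def multilinear_maps_def gcirc_def)
qed

lemma gerstenhaber_bracket_in_cochains:
  assumes "vector_space scale" and P: "P \<in> cochains scale p" and Q: "Q \<in> cochains scale q"
  shows "gerstenhaber_bracket scale p q P Q \<in> cochains scale (p + q)"
proof -
  interpret vector_space scale by fact
  interpret vector_space_pair scale scale ..
  have "gcirc scale p q P Q \<in> cochains scale (p + q)" "gcirc scale q p Q P \<in> cochains scale (p + q)"
    using gcirc_in_cochains[OF assms] gcirc_in_cochains[OF assms(1) Q P] by (simp_all add: add.commute)
  then show ?thesis
    by (auto simp: cochains_def multilinear_maps_def gerstenhaber_bracket_def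
        intro!: linear_compose_sub linear_compose_scale_right)
qed
end

theory Submission
  imports Defs
begin

text \<open>Let \<open>m = n - 1\<close> be the degree of \<open>f\<close> and expand the bracket
  into its two compositions. Inserting \<open>f\<close> into the two slots of the product gives the
  outer terms of the coboundary (\<open>gcirc_mult_cochain_left\<close>); inserting the product into
  the slots of \<open>f\<close> gives the inner terms (\<open>gcirc_mult_cochain_right\<close>).
  What remains is to compare signs, and the factor \<open>(- 1) ^ m\<close> makes them
  agree.\<close>

lemma mult_cochain_take_drop:
  assumes "Suc k < length xs"
  shows "mult_cochain (take 2 (drop k xs)) = xs ! k * xs ! Suc k"
  using assms by (simp add: mult_cochain_def)

context assoc_algebra
begin

lemma gcirc_mult_cochain_left:
  assumes "length xs = m + 2"
  shows "gcirc scale 1 m mult_cochain f xs =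
    f (take (m + 1) xs) * xs ! (m + 1) + scale ((- 1) ^ m) (xs ! 0 * f (drop 1 xs))"
proof -
  obtain y ys where xs: "xs = y # ys" "length ys = m + 1"
    using assms by (cases xs) auto
  \<comment> \<open>With \<open>f\<close> in the first slot, its \<open>m + 1\<close> arguments
    leave just the last entry for the second slot.\<close>
  have "drop m ys = [ys ! m]"
    using xs(2) by (simp flip: Cons_nth_drop_Suc)
  moreover have "{1..1+1::nat} = {1, 2}"
    by auto
  ultimately show ?thesis
    using xs by (simp add: gcirc_def mult_cochain_def)
qed

text \<open>The product has degree 1, so insertion at \<open>i\<close> carries the sign
  \<open>(- 1) ^ (i - 1)\<close>, one factor -1 away from the Hochschild sign.\<close>

lemma gcirc_mult_cochain_right:
  assumes "length xs = m + 2"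
  shows "gcirc scale m 1 f mult_cochain xs = - (\<Sum>i=1..m+1. scale ((- 1) ^ i)
    (f (take (i - 1) xs @ [xs ! (i - 1) * xs ! i] @ drop (i + 1) xs)))"
proof -
  have "scale ((- 1) ^ ((i - 1) * 1))
      (f (take (i - 1) xs @ [mult_cochain (take (1 + 1) (drop (i - 1) xs))] @ drop (i + 1) xs)) =
    - scale ((- 1) ^ i) (f (take (i - 1) xs @ [xs ! (i - 1) * xs ! i] @ drop (i + 1) xs))"
    if i: "i \<in> {1..m+1}" for i
  proof -
    \<comment> \<open>This removes the truncated \<open>i - 1\<close>; the bound on \<open>k\<close>
      keeps both factors inside the list.\<close>
    obtain k where "i = Suc k" "k \<le> m"
      using i by (cases i) auto
    then show ?thesis
      using assms mult_cochain_take_drop[of k xs] by (simp add: numeral_2_eq_2)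
  qed
  moreover have "length xs = m + 1 + 1"
    using assms by simp
  ultimately show ?thesis
    unfolding gcirc_def sum_negf[symmetric] by (simp only: refl if_True cong: sum.cong)
qed

lemma hochschild_d_eq_d_pi:
  "hochschild_d scale (Suc m) f xs = scale ((- 1) ^ m) (d_pi scale m f xs)"
proof (cases "length xs = m + 2")
  case True
  let ?S = "\<Sum>i=1..m+1. scale ((- 1) ^ i)
    (f (take (i - 1) xs @ [xs ! (i - 1) * xs ! i] @ drop (i + 1) xs))"
  have "d_pi scale m f xs = f (take (m + 1) xs) * xs ! (m + 1)
      + scale ((- 1) ^ m) (xs ! 0 * f (drop 1 xs)) + scale ((- 1) ^ m) ?S"
    unfolding d_pi_def gerstenhaber_bracket_def gcirc_mult_cochain_left[OF True]
      gcirc_mult_cochain_right[OF True]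
    \<comment> \<open>The minus sign of the bracket cancels the one in front of the inner
      sum.\<close>
    by (simp only: mult_1 scale_minus_right diff_minus_eq_add)
  \<comment> \<open>Multiplying by \<open>(- 1) ^ m\<close> thus clears two signs and gives the last
    term its sign, since \<open>(- 1) ^ (n + 1) = (- 1) ^ m\<close>.\<close>
  moreover have "(- 1) ^ m * (- 1) ^ m = (1 :: 'k)"
    by (simp flip: power_mult_distrib)
  ultimately have "scale ((- 1) ^ m) (d_pi scale m f xs) =
      xs ! 0 * f (drop 1 xs) + ?S + scale ((- 1) ^ m) (f (take (m + 1) xs) * xs ! (m + 1))"
    by (simp only: scale_right_distrib scale_scale scale_one add_ac)
  with True show ?thesis
    by (simp add: hochschild_d_def)
next
  \<comment> \<open>On lists of any other length both sides are 0 by convention.\<close>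
  case False
  then show ?thesis
    by (simp add: hochschild_d_def d_pi_def gerstenhaber_bracket_def gcirc_def)
qed

end

theorem proposition3p13:
  fixes scale :: "'k::field_char_0 \<Rightarrow> 'g::ring \<Rightarrow> 'g"
    and n :: nat
    and f :: "'g list \<Rightarrow> 'g"
  assumes "assoc_algebra scale"
    and "n \<ge> 1"
    and "f \<in> cochains scale (n - 1)"
  shows "hochschild_d scale n f = (\<lambda>xs. scale ((- 1) ^ (n - 1)) (d_pi scale (n - 1) f xs))
    \<and> (\<lambda>xs. scale ((- 1) ^ (n - 1)) (d_pi scale (n - 1) f xs))
      = (\<lambda>xs. scale ((- 1) ^ (n - 1)) (gerstenhaber_bracket scale 1 (n - 1) mult_cochain f xs))"
proof -
  interpret assoc_algebra scale by fact
  obtain m where "n = Suc m"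
    using \<open>n \<ge> 1\<close> by (cases n) auto
  then show ?thesis
    by (simp add: hochschild_d_eq_d_pi d_pi_def fun_eq_iff)
qed

end
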